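(* Let $\mathcal{M}$ be an $\mathscr{L}$-structure with underlying set $M$ such that $|M|$ is an infinite regular cardinal. Suppose $\mathcal{M}$ is indivisible, ultrahomogeneous, and has universal duplication of quantifier-free types. Then $\mathcal{M}$ is sunflowerable.
   Context: $\mathscr{L}$ is a first-order language all of whose function and relation symbols have finite arity. Script letters denote structures, Roman letters their underlying sets. For $B\subseteq M$, $\mathcal{M}\restriction_B$ is the substructure of $\mathcal{M}$ with underlying set $B$. Tuples may be infinite; $\mathrm{qtp}_{\mathcal{M}}(\mathbf{a})$ denotes the complete quantifier-free type of the tuple $\mathbf{a}$ in $\mathcal{M}$ (the set of literals true of $\mathbf{a}$). A set $Y$ of finite sets is a sunflower if there is a set $r$ such that $p\cap q=r$ for all distinct $p,q\in Y$. For $n\in\omega$, an infinite $\mathscr{L}$-structure $\mathcal{M}$ is $n$-sunflowerable if for every $\mathscr{L}$-structure $\mathcal{Y}\cong\mathcal{M}$ all of whose elements are sets of size $n$, there is a substructure $\mathcal{Z}\subseteq\mathcal{Y}$ with $\mathcal{Z}\cong\mathcal{Y}$ whose underlying set $Z$ is a sunflower. $\mathcal{M}$ is sunflowerable if it is $n$-sunflowerable for every $n\in\omega$. $\mathcal{M}$ is indivisible if whenever $(P_i)_{i\in\alpha}$ is a partition of $M$ with $\alpha<|M|$, there are $i\in\alpha$ and $Q\subseteq P_i$ with $\mathcal{M}\restriction_Q\cong\mathcal{M}$. $\mathcal{M}$ is ultrahomogeneous if whenever $\mathbf{a},\mathbf{b}$ are tuples from $\mathcal{M}$ of length $<|M|$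 with $\mathrm{qtp}_{\mathcal{M}}(\mathbf{a})=\mathrm{qtp}_{\mathcal{M}}(\mathbf{b})$ and $a\in M$, there is $b\in M$ with $\mathrm{qtp}_{\mathcal{M}}(\mathbf{a},a)=\mathrm{qtp}_{\mathcal{M}}(\mathbf{b},b)$. For a tuple $\mathbf{a}$ from $\mathcal{M}$ and $a\in M$ not in $\mathbf{a}$, let $B_{\mathbf{a},a}=\{b\in M: \mathrm{qtp}_{\mathcal{M}}(\mathbf{a},a)=\mathrm{qtp}_{\mathcal{M}}(\mathbf{a},b)\}$. $\mathcal{M}$ has universal duplication of quantifier-free types if for every tuple $\mathbf{a}$ from $\mathcal{M}$ of length $<|M|$ and every $a\in M$ not in $\mathbf{a}$, there is $C\subseteq B_{\mathbf{a},a}$ with $\mathcal{M}\restriction_C\cong\mathcal{M}$. *)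

theory Defs
  imports "HOL-Library.Disjoint_Sets"
begin

unbundle cardinal_syntax

section \<open>First-order languages and structures\<close>

text \<open>A language carries explicit sets of symbols, since types are never empty and the language
  may have no function symbols or no relation symbols. Constants are function symbols of arity 0.\<close>

record ('f, 'r) language =
  fun_syms :: "'f set"
  rel_syms :: "'r set"
  fun_arity :: "'f \<Rightarrow> nat"
  rel_arity :: "'r \<Rightarrow> nat"

text \<open>Interpretations are only meaningful for symbols of the language and for argument lists over
  the universe whose length is the arity; all other values are ignored below.\<close>

record ('a, 'f, 'r) struct =
  universe :: "'a set"
  fun_int :: "'f \<Rightarrow> 'a list \<Rightarrow> 'a"
  rel_int :: "'r \<Rightarrow> 'a list \<Rightarrow> bool"

definition is_structure :: "('f, 'r) language \<Rightarrow> ('a, 'f, 'r) struct \<Rightarrow> bool" where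
  "is_structure L M \<longleftrightarrow>
     (\<forall>f \<in> fun_syms L. \<forall>xs \<in> lists (universe M).
        length xs = fun_arity L f \<longrightarrow> fun_int M f xs \<in> universe M)"

definition is_substructure ::
    "('f, 'r) language \<Rightarrow> ('a, 'f, 'r) struct \<Rightarrow> ('a, 'f, 'r) struct \<Rightarrow> bool" where
  "is_substructure L N M \<longleftrightarrow>
     is_structure L N \<and> is_structure L M \<and> universe N \<subseteq> universe M \<and>
     (\<forall>f \<in> fun_syms L. \<forall>xs \<in> lists (universe N).
        length xs = fun_arity L f \<longrightarrow> fun_int N f xs = fun_int M f xs) \<and>
     (\<forall>R \<in> rel_syms L. \<forall>xs \<in> lists (universe N).
        length xs = rel_arity L R \<longrightarrow> rel_int N R xs = rel_int M R xs)"

definition is_isomorphism ::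
    "('f, 'r) language \<Rightarrow> ('a \<Rightarrow> 'b) \<Rightarrow> ('a, 'f, 'r) struct \<Rightarrow> ('b, 'f, 'r) struct \<Rightarrow> bool" where
  "is_isomorphism L h M N \<longleftrightarrow>
     is_structure L M \<and> is_structure L N \<and> bij_betw h (universe M) (universe N) \<and>
     (\<forall>f \<in> fun_syms L. \<forall>xs \<in> lists (universe M).
        length xs = fun_arity L f \<longrightarrow> h (fun_int M f xs) = fun_int N f (map h xs)) \<and>
     (\<forall>R \<in> rel_syms L. \<forall>xs \<in> lists (universe M).
        length xs = rel_arity L R \<longrightarrow> rel_int M R xs = rel_int N R (map h xs))"

definition isomorphic ::
    "('f, 'r) language \<Rightarrow> ('a, 'f, 'r) struct \<Rightarrow> ('b, 'f, 'r) struct \<Rightarrow> bool" where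
  "isomorphic L M N \<longleftrightarrow> (\<exists>h. is_isomorphism L h M N)"

text \<open>This is a structure only if \<open>B\<close> is closed under the functions of \<open>M\<close>. A statement
  \<open>isomorphic L (restrict_to M B) N\<close> includes that requirement, via \<open>is_isomorphism\<close>.\<close>

definition restrict_to :: "('a, 'f, 'r) struct \<Rightarrow> 'a set \<Rightarrow> ('a, 'f, 'r) struct" where
  "restrict_to M B = M\<lparr>universe := B\<rparr>"

section \<open>Quantifier-free types\<close>

datatype ('f, 'v) trm = Var 'v | Fn 'f "('f, 'v) trm list"

datatype ('f, 'r, 'v) atom = Eq "('f, 'v) trm" "('f, 'v) trm" | Rel 'r "('f, 'v) trm list"

datatype ('f, 'r, 'v) literal = Pos "('f, 'r, 'v) atom" | Neg "('f, 'r, 'v) atom"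

fun wf_trm :: "('f, 'r) language \<Rightarrow> 'v set \<Rightarrow> ('f, 'v) trm \<Rightarrow> bool" where
  "wf_trm L J (Var v) \<longleftrightarrow> v \<in> J"
| "wf_trm L J (Fn f ts) \<longleftrightarrow>
     f \<in> fun_syms L \<and> length ts = fun_arity L f \<and> (\<forall>t \<in> set ts. wf_trm L J t)"

fun wf_atom :: "('f, 'r) language \<Rightarrow> 'v set \<Rightarrow> ('f, 'r, 'v) atom \<Rightarrow> bool" where
  "wf_atom L J (Eq s t) \<longleftrightarrow> wf_trm L J s \<and> wf_trm L J t"
| "wf_atom L J (Rel R ts) \<longleftrightarrow>
     R \<in> rel_syms L \<and> length ts = rel_arity L R \<and> (\<forall>t \<in> set ts. wf_trm L J t)"

fun wf_literal :: "('f, 'r) language \<Rightarrow> 'v set \<Rightarrow> ('f, 'r, 'v) literal \<Rightarrow> bool" where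
  "wf_literal L J (Pos A) \<longleftrightarrow> wf_atom L J A"
| "wf_literal L J (Neg A) \<longleftrightarrow> wf_atom L J A"

fun eval_trm :: "('a, 'f, 'r) struct \<Rightarrow> ('v \<Rightarrow> 'a) \<Rightarrow> ('f, 'v) trm \<Rightarrow> 'a" where
  "eval_trm M s (Var v) = s v"
| "eval_trm M s (Fn f ts) = fun_int M f (map (eval_trm M s) ts)"

fun sat_atom :: "('a, 'f, 'r) struct \<Rightarrow> ('v \<Rightarrow> 'a) \<Rightarrow> ('f, 'r, 'v) atom \<Rightarrow> bool" where
  "sat_atom M s (Eq t u) \<longleftrightarrow> eval_trm M s t = eval_trm M s u"
| "sat_atom M s (Rel R ts) \<longleftrightarrow> rel_int M R (map (eval_trm M s) ts)"

fun sat_literal :: "('a, 'f, 'r) struct \<Rightarrow> ('v \<Rightarrow> 'a) \<Rightarrow> ('f, 'r, 'v) literal \<Rightarrow> bool" where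
  "sat_literal M s (Pos A) \<longleftrightarrow> sat_atom M s A"
| "sat_literal M s (Neg A) \<longleftrightarrow> \<not> sat_atom M s A"

text \<open>A (possibly infinite) tuple is a family \<open>s\<close> over an index set \<open>J\<close>, and the indices serve as
  the variables of its type.\<close>

definition qtp ::
    "('f, 'r) language \<Rightarrow> ('a, 'f, 'r) struct \<Rightarrow> 'v set \<Rightarrow> ('v \<Rightarrow> 'a) \<Rightarrow> ('f, 'r, 'v) literal set" where
  "qtp L M J s = {\<phi>. wf_literal L J \<phi> \<and> sat_literal M s \<phi>}"

text \<open>The type of the tuple \<open>s\<close> extended by one further entry \<open>x\<close>, whose index is \<open>None\<close>.\<close>

definition qtp_snoc ::
    "('f, 'r) language \<Rightarrow> ('a, 'f, 'r) struct \<Rightarrow> 'v set \<Rightarrow> ('v \<Rightarrow> 'a) \<Rightarrow> 'a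
       \<Rightarrow> ('f, 'r, 'v option) literal set" where
  "qtp_snoc L M J s x = qtp L M (insert None (Some ` J)) (case_option x s)"

section \<open>Indivisibility, ultrahomogeneity, duplication of types\<close>

text \<open>In this section an ordinal \<open>\<alpha> < |M|\<close> that indexes a partition or a tuple is replaced by an
  index set of cardinality less than \<open>|M|\<close>; such a set can always be found in the type of the
  elements of \<open>M\<close>, and the order of the indices plays no role.\<close>

definition indivisible :: "('f, 'r) language \<Rightarrow> ('a, 'f, 'r) struct \<Rightarrow> bool" where
  "indivisible L M \<longleftrightarrow>
     (\<forall>(I :: 'a set) P. |I| <o |universe M| \<and> disjoint_family_on P I \<and> (\<Union>i\<in>I. P i) = universe M \<longrightarrow>
        (\<exists>i \<in> I. \<exists>Q \<subseteq> P i. isomorphic L (restrict_to M Q) M))"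

definition ultrahomogeneous :: "('f, 'r) language \<Rightarrow> ('a, 'f, 'r) struct \<Rightarrow> bool" where
  "ultrahomogeneous L M \<longleftrightarrow>
     (\<forall>(J :: 'a set) s t. |J| <o |universe M| \<and> s \<in> J \<rightarrow> universe M \<and> t \<in> J \<rightarrow> universe M \<and>
          qtp L M J s = qtp L M J t \<longrightarrow>
        (\<forall>a \<in> universe M. \<exists>b \<in> universe M. qtp_snoc L M J s a = qtp_snoc L M J t b))"

definition same_type_set ::
    "('f, 'r) language \<Rightarrow> ('a, 'f, 'r) struct \<Rightarrow> 'v set \<Rightarrow> ('v \<Rightarrow> 'a) \<Rightarrow> 'a \<Rightarrow> 'a set" where
  "same_type_set L M J s a = {b \<in> universe M. qtp_snoc L M J s a = qtp_snoc L M J s b}"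

definition universal_duplication_qtp :: "('f, 'r) language \<Rightarrow> ('a, 'f, 'r) struct \<Rightarrow> bool" where
  "universal_duplication_qtp L M \<longleftrightarrow>
     (\<forall>(J :: 'a set) s. |J| <o |universe M| \<and> s \<in> J \<rightarrow> universe M \<longrightarrow>
        (\<forall>a \<in> universe M - s ` J. \<exists>C \<subseteq> same_type_set L M J s a. isomorphic L (restrict_to M C) M))"

section \<open>Sunflowers\<close>

definition sunflower :: "'b set set \<Rightarrow> bool" where
  "sunflower Y \<longleftrightarrow> (\<forall>p \<in> Y. finite p) \<and> (\<exists>r. \<forall>p \<in> Y. \<forall>q \<in> Y. p \<noteq> q \<longrightarrow> p \<inter> q = r)"

text \<open>The type argument is the type of the points of the \<open>n\<close>-element sets making up the isomorphic
  copies of \<open>M\<close>. Sunflowerability means that the predicate holds for every such type, so results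
  are to be stated for an arbitrary type variable \<open>'b\<close>.\<close>

definition n_sunflowerable ::
    "'b itself \<Rightarrow> ('f, 'r) language \<Rightarrow> nat \<Rightarrow> ('a, 'f, 'r) struct \<Rightarrow> bool" where
  "n_sunflowerable TYPE('b) L n M \<longleftrightarrow>
     infinite (universe M) \<and>
     (\<forall>Y :: ('b set, 'f, 'r) struct.
        isomorphic L Y M \<and> (\<forall>p \<in> universe Y. finite p \<and> card p = n) \<longrightarrow>
        (\<exists>Z. is_substructure L Z Y \<and> isomorphic L Z Y \<and> sunflower (universe Z)))"

definition sunflowerable ::
    "'b itself \<Rightarrow> ('f, 'r) language \<Rightarrow> ('a, 'f, 'r) struct \<Rightarrow> bool" where
  "sunflowerable TYPE('b) L M \<longleftrightarrow> (\<forall>n. n_sunflowerable TYPE('b) L n M)"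

end

(* Induct on the size n of the sets. If some point c lies in every set of some copy of M, delete c
   from these sets, apply the induction hypothesis and put c back. Otherwise indivisibility shows
   that, for every set S of fewer than |M| points, every copy of M contains a set disjoint from S.
   Then a copy of M consisting of pairwise disjoint sets is chosen by recursion along a well-order
   of M of type |M|: ultrahomogeneity extends the partial copy by an element of the right
   quantifier-free type, and by duplication of types the realizations of this type contain a copy
   of M, hence a set disjoint from all those chosen before. *)

theory Submission
  imports Defs
begin

section \<open>Embeddings\<close>

text \<open>A self-embedding of \<open>M\<close> encodes the copy of \<open>M\<close> on its range.
  Passing to a copy inside a copy then becomes composition of maps.\<close>

definition embedding ::
    "('f, 'r) language \<Rightarrow> ('a \<Rightarrow> 'b) \<Rightarrow> ('a, 'f, 'r) struct \<Rightarrow> ('b, 'f, 'r) struct \<Rightarrow> bool" where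
  "embedding L h M N \<longleftrightarrow>
     is_structure L M \<and> is_structure L N \<and> inj_on h (universe M) \<and> h ` universe M \<subseteq> universe N \<and>
     (\<forall>f \<in> fun_syms L. \<forall>xs \<in> lists (universe M).
        length xs = fun_arity L f \<longrightarrow> h (fun_int M f xs) = fun_int N f (map h xs)) \<and>
     (\<forall>R \<in> rel_syms L. \<forall>xs \<in> lists (universe M).
        length xs = rel_arity L R \<longrightarrow> rel_int M R xs = rel_int N R (map h xs))"

lemma map_in_lists: "h ` A \<subseteq> B \<Longrightarrow> xs \<in> lists A \<Longrightarrow> map h xs \<in> lists B"
  by (auto simp: in_lists_conv_set)

lemma embedding_comp:
  assumes h: "embedding L h M N" and k: "embedding L k N K"
  shows "embedding L (k \<circ> h) M K"
  unfolding embedding_def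
proof (intro conjI ballI impI)
  have hU: "h ` universe M \<subseteq> universe N" using h by (simp add: embedding_def)
  have lists: "map h xs \<in> lists (universe N)" if "xs \<in> lists (universe M)" for xs
    using hU that by (rule map_in_lists)
  show "is_structure L M" "is_structure L K" using h k by (simp_all add: embedding_def)
  show "inj_on (k \<circ> h) (universe M)"
    using h k by (auto simp: embedding_def intro: comp_inj_on inj_on_subset)
  show "(k \<circ> h) ` universe M \<subseteq> universe K"
    using h k by (auto simp: embedding_def)
  show "(k \<circ> h) (fun_int M f xs) = fun_int K f (map (k \<circ> h) xs)"
    if "f \<in> fun_syms L" "xs \<in> lists (universe M)" "length xs = fun_arity L f" for f xs
  proof -
    have "h (fun_int M f xs) = fun_int N f (map h xs)"
      using h that unfolding embedding_def by blast
    moreover have "k (fun_int N f (map h xs)) = fun_int K f (map k (map h xs))"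
      using k that(1,3) lists[OF that(2)] unfolding embedding_def by (metis length_map)
    ultimately show ?thesis by simp
  qed
  show "rel_int M R xs = rel_int K R (map (k \<circ> h) xs)"
    if "R \<in> rel_syms L" "xs \<in> lists (universe M)" "length xs = rel_arity L R" for R xs
  proof -
    have "rel_int M R xs = rel_int N R (map h xs)"
      using h that unfolding embedding_def by blast
    moreover have "rel_int N R (map h xs) = rel_int K R (map k (map h xs))"
      using k that(1,3) lists[OF that(2)] unfolding embedding_def by (metis length_map)
    ultimately show ?thesis by simp
  qed
qed

lemma is_isomorphism_imp_embedding: "is_isomorphism L h M N \<Longrightarrow> embedding L h M N"
  by (auto simp: is_isomorphism_def embedding_def bij_betw_def)

lemma is_isomorphism_inv_into:
  assumes "is_isomorphism L h M N"
  shows "is_isomorphism L (inv_into (universe M) h) N M"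
proof -
  let ?k = "inv_into (universe M) h"
  have h: "bij_betw h (universe M) (universe N)" and M: "is_structure L M"
    using assms by (auto simp: is_isomorphism_def)
  then have k: "bij_betw ?k (universe N) (universe M)"
    by (simp add: bij_betw_inv_into)
  have hk: "map h (map ?k xs) = xs" if "xs \<in> lists (universe N)" for xs
    using h that by (induction xs) (auto simp: bij_betw_inv_into_right)
  have kl: "map ?k xs \<in> lists (universe M)" if "xs \<in> lists (universe N)" for xs
    using k that by (intro map_in_lists) (auto simp: bij_betw_def)
  have "?k (fun_int N f xs) = fun_int M f (map ?k xs)"
    if "f \<in> fun_syms L" "xs \<in> lists (universe N)" "length xs = fun_arity L f" for f xs
  proof -
    have "h (fun_int M f (map ?k xs)) = fun_int N f (map h (map ?k xs))"
      using assms kl that unfolding is_isomorphism_def by (metis length_map)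
    moreover have "fun_int M f (map ?k xs) \<in> universe M"
      using M kl that unfolding is_structure_def by (metis length_map)
    ultimately show ?thesis
      using h hk that by (metis bij_betw_inv_into_left)
  qed
  moreover have "rel_int N R xs = rel_int M R (map ?k xs)"
    if "R \<in> rel_syms L" "xs \<in> lists (universe N)" "length xs = rel_arity L R" for R xs
    using assms kl hk that unfolding is_isomorphism_def by (metis length_map)
  ultimately show ?thesis
    using assms k by (auto simp: is_isomorphism_def)
qed

lemma restrict_to_simps [simp]:
  "universe (restrict_to M B) = B"
  "fun_int (restrict_to M B) = fun_int M"
  "rel_int (restrict_to M B) = rel_int M"
  by (auto simp: restrict_to_def)

text \<open>The given isomorphism runs from the copy to \<open>M\<close>, so its inverse is the
  embedding. This puts the copies supplied by indivisibility and by duplication of types into the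
  form of maps.\<close>

lemma isomorphic_restrict_imp_embedding:
  assumes "isomorphic L (restrict_to M Q) M" "is_structure L M" "Q \<subseteq> universe M"
  obtains e where "embedding L e M M" "e ` universe M = Q"
proof -
  obtain h where "is_isomorphism L h (restrict_to M Q) M"
    using assms by (auto simp: isomorphic_def)
  from is_isomorphism_inv_into[OF this]
  have "is_isomorphism L (inv_into Q h) M (restrict_to M Q)"
    by simp
  then have "embedding L (inv_into Q h) M M" "inv_into Q h ` universe M = Q"
    using assms by (auto simp: is_isomorphism_def embedding_def bij_betw_def)
  then show ?thesis by (rule that)
qed

text \<open>The way back from embeddings to substructures: a list over the range is the image of a
  list over \<open>M\<close>, so the range is closed under the functions of
  \<open>N\<close>.\<close>

lemma embedding_image:
  assumes "embedding L e M N"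
  shows "is_substructure L (restrict_to N (e ` universe M)) N"
    and "isomorphic L (restrict_to N (e ` universe M)) M"
proof -
  have *: "is_structure L (restrict_to N (e ` universe M))"
    unfolding is_structure_def
  proof (intro ballI impI)
    fix f xs
    assume f: "f \<in> fun_syms L" "length xs = fun_arity L f"
      and "xs \<in> lists (universe (restrict_to N (e ` universe M)))"
    then have "xs \<in> map e ` lists (universe M)"
      by (simp add: lists_image)
    then obtain ys where ys: "xs = map e ys" "ys \<in> lists (universe M)"
      by auto
    then have "fun_int N f xs = e (fun_int M f ys)" "fun_int M f ys \<in> universe M"
      using assms f by (auto simp: embedding_def is_structure_def)
    then show "fun_int (restrict_to N (e ` universe M)) f xs
                 \<in> universe (restrict_to N (e ` universe M))"
      by simp
  qed
  then show "is_substructure L (restrict_to N (e ` universe M)) N"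
    using assms by (auto simp: embedding_def is_substructure_def)
  have "is_isomorphism L e M (restrict_to N (e ` universe M))"
    using assms * by (auto simp: embedding_def is_isomorphism_def bij_betw_def)
  then show "isomorphic L (restrict_to N (e ` universe M)) M"
    unfolding isomorphic_def by (blast dest: is_isomorphism_inv_into)
qed

section \<open>Quantifier-free types\<close>

lemma finite_set2_trm [simp]: "finite (set2_trm t)"
  by (induction t) auto

lemma finite_set3_literal [simp]: "finite (set3_literal \<phi>)"
proof -
  have "finite (set3_atom A)" for A :: "('f, 'r, 'v) atom"
    by (cases A) auto
  then show ?thesis by (cases \<phi>) auto
qed

lemma wf_trm_vars: "wf_trm L J t \<Longrightarrow> set2_trm t \<subseteq> J"
  by (induction t) auto

lemma wf_atom_vars: "wf_atom L J A \<Longrightarrow> set3_atom A \<subseteq> J"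
  by (cases A) (auto dest: wf_trm_vars)

lemma wf_literal_vars: "wf_literal L J \<phi> \<Longrightarrow> set3_literal \<phi> \<subseteq> J"
  by (cases \<phi>) (auto dest: wf_atom_vars)

lemma wf_trm_map: "wf_trm L J t \<Longrightarrow> \<rho> ` set2_trm t \<subseteq> K \<Longrightarrow> wf_trm L K (map_trm id \<rho> t)"
  by (induction t) (auto simp: image_subset_iff)

lemma wf_atom_map: "wf_atom L J A \<Longrightarrow> \<rho> ` set3_atom A \<subseteq> K \<Longrightarrow> wf_atom L K (map_atom id id \<rho> A)"
  by (cases A) (auto simp: image_subset_iff intro!: wf_trm_map)

lemma wf_literal_map:
  "wf_literal L J \<phi> \<Longrightarrow> \<rho> ` set3_literal \<phi> \<subseteq> K \<Longrightarrow> wf_literal L K (map_literal id id \<rho> \<phi>)"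
  by (cases \<phi>) (auto intro!: wf_atom_map)

lemma wf_literal_weaken: "wf_literal L J \<phi> \<Longrightarrow> set3_literal \<phi> \<subseteq> K \<Longrightarrow> wf_literal L K \<phi>"
  using wf_literal_map[of L J \<phi> id K] by (simp add: literal.map_id)

lemma eval_trm_map: "eval_trm M s (map_trm id \<rho> t) = eval_trm M (s \<circ> \<rho>) t"
  by (induction t) (auto cong: map_cong simp: comp_def)

lemma sat_atom_map: "sat_atom M s (map_atom id id \<rho> A) = sat_atom M (s \<circ> \<rho>) A"
  by (cases A) (auto simp: eval_trm_map comp_def)

lemma sat_literal_map: "sat_literal M s (map_literal id id \<rho> \<phi>) = sat_literal M (s \<circ> \<rho>) \<phi>"
  by (cases \<phi>) (auto simp: sat_atom_map)

lemma eval_trm_cong: "(\<And>v. v \<in> set2_trm t \<Longrightarrow> s v = s' v) \<Longrightarrow> eval_trm M s t = eval_trm M s' t"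
proof (induction t)
  case (Fn f ts)
  then have "map (eval_trm M s) ts = map (eval_trm M s') ts"
    by (intro map_cong) auto
  then show ?case by (simp only: eval_trm.simps)
qed simp

lemma sat_atom_cong:
  assumes "\<And>v. v \<in> set3_atom A \<Longrightarrow> s v = s' v"
  shows "sat_atom M s A = sat_atom M s' A"
proof (cases A)
  case (Eq t u)
  then have "eval_trm M s t = eval_trm M s' t" "eval_trm M s u = eval_trm M s' u"
    using assms by (auto intro!: eval_trm_cong)
  with Eq show ?thesis by simp
next
  case (Rel R ts)
  then have "map (eval_trm M s) ts = map (eval_trm M s') ts"
    using assms by (auto intro!: eval_trm_cong)
  with Rel show ?thesis by (simp only: sat_atom.simps)
qed

lemma sat_literal_cong:
  assumes "\<And>v. v \<in> set3_literal \<phi> \<Longrightarrow> s v = s' v"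
  shows "sat_literal M s \<phi> = sat_literal M s' \<phi>"
proof (cases \<phi>)
  case (Pos A)
  then show ?thesis using assms sat_atom_cong[of A s s' M] by simp
next
  case (Neg A)
  then show ?thesis using assms sat_atom_cong[of A s s' M] by simp
qed

section \<open>Comparing quantifier-free types\<close>

lemma qtp_eq_iff:
  "qtp L M J s = qtp L N J t \<longleftrightarrow>
     (\<forall>\<phi>. wf_literal L J \<phi> \<longrightarrow> sat_literal M s \<phi> = sat_literal N t \<phi>)"
  by (auto simp: qtp_def)

lemma qtp_empty: "qtp L M {} s = qtp L M {} t"
  unfolding qtp_eq_iff by (intro allI impI sat_literal_cong) (auto dest: wf_literal_vars)

text \<open>Renaming the variable \<open>i\<close> to \<open>None\<close>, and every other
  \<open>v\<close> to \<open>Some v\<close>, turns a literal over \<open>insert i J\<close> into one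
  about the extended tuple, with the same truth value.\<close>

lemma qtp_insert_if_qtp_snoc:
  fixes M :: "('a, 'f, 'r) struct" and J :: "'v set"
  assumes "qtp_snoc L M J s (s i) = qtp_snoc L M J t (t i)"
  shows "qtp L M (insert i J) s = qtp L M (insert i J) t"
  unfolding qtp_eq_iff
proof (intro allI impI)
  fix \<phi> assume \<phi>: "wf_literal L (insert i J) \<phi>"
  define \<rho> where "\<rho> v = (if v = i then None else Some v)" for v
  have 1: "case_option (u i) u \<circ> \<rho> = u" for u :: "'v \<Rightarrow> 'a"
    by (auto simp: \<rho>_def)
  have "wf_literal L (insert None (Some ` J)) (map_literal id id \<rho> \<phi>)"
    using wf_literal_vars[OF \<phi>] by (intro wf_literal_map[OF \<phi>]) (auto simp: \<rho>_def)
  then show "sat_literal M s \<phi> = sat_literal M t \<phi>"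
    using assms unfolding qtp_snoc_def qtp_eq_iff
    by (metis 1 sat_literal_map)
qed

text \<open>A literal mentions only finitely many variables. The set \<open>K\<close> only has to
  contain \<open>F\<close>, so that an initial segment of a well-order can be used for it.\<close>

lemma qtp_eqI_finite:
  assumes "\<And>F. finite F \<Longrightarrow> F \<subseteq> J \<Longrightarrow> \<exists>K. F \<subseteq> K \<and> qtp L M K s = qtp L M K t"
  shows "qtp L M J s = qtp L M J t"
  unfolding qtp_eq_iff
proof (intro allI impI)
  fix \<phi> assume \<phi>: "wf_literal L J \<phi>"
  obtain K where "set3_literal \<phi> \<subseteq> K" "qtp L M K s = qtp L M K t"
    using assms[OF finite_set3_literal wf_literal_vars[OF \<phi>]] by auto
  then show "sat_literal M s \<phi> = sat_literal M t \<phi>"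
    using wf_literal_weaken[OF \<phi>] by (auto simp: qtp_eq_iff)
qed

lemma Well_order_finite_has_max:
  assumes "Well_order r" "finite F" "F \<noteq> {}" "F \<subseteq> Field r"
  shows "\<exists>j\<in>F. F \<subseteq> insert j (underS r j)"
  using assms(2-4)
proof (induction rule: finite_ne_induct)
  case (insert x F)
  then obtain j where j: "j \<in> F" "F \<subseteq> insert j (underS r j)" by auto
  have r: "Total r" "trans r" "antisym r"
    using assms(1) by (auto simp: order_on_defs)
  consider "x = j" | "(x, j) \<in> r" "x \<noteq> j" | "(j, x) \<in> r" "x \<noteq> j"
    using r(1) j insert.prems unfolding total_on_def by blast
  then show ?case
  proof cases
    case 3
    then have "underS r j \<subseteq> underS r x"
      using r by (auto simp: underS_def dest: transD antisymD)
    with 3 j show ?thesis by (auto simp: underS_def)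
  qed (use j in \<open>auto simp: underS_def\<close>)
qed auto

text \<open>A nonempty finite set of variables has a greatest element \<open>j\<close> and lies in
  the segment up to and including \<open>j\<close>, where the hypothesis at \<open>j\<close> settles
  the matter. Limit stages thus require no separate argument.\<close>

lemma qtp_eqI_Well_order:
  assumes "Well_order r" "J \<subseteq> Field r"
    and "\<And>j. j \<in> J \<Longrightarrow> qtp_snoc L M (underS r j) s (s j) = qtp_snoc L M (underS r j) t (t j)"
  shows "qtp L M J s = qtp L M J t"
proof (rule qtp_eqI_finite)
  fix F assume F: "finite F" "F \<subseteq> J"
  show "\<exists>K. F \<subseteq> K \<and> qtp L M K s = qtp L M K t"
  proof (cases "F = {}")
    case True
    then show ?thesis using qtp_empty by blast
  next
    case False
    with Well_order_finite_has_max[OF assms(1)] F assms(2)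
    obtain j where j: "j \<in> F" "F \<subseteq> insert j (underS r j)" by (meson subset_trans)
    with F assms(3)[of j] show ?thesis
      using qtp_insert_if_qtp_snoc[of L M "underS r j" s j t] by blast
  qed
qed

text \<open>The type records whether the new entry equals an old one. This makes duplication of
  types applicable to an element found by ultrahomogeneity.\<close>

lemma qtp_snoc_eq_notin:
  assumes "qtp_snoc L M J s a = qtp_snoc L M J t b" "a \<notin> s ` J"
  shows "b \<notin> t ` J"
proof
  assume "b \<in> t ` J"
  then obtain j where j: "j \<in> J" "b = t j" by auto
  let ?\<phi> = "Pos (Eq (Var None) (Var (Some j)))"
  have "sat_literal M (case_option a s) ?\<phi> = sat_literal M (case_option b t) ?\<phi>"
    using assms(1) j unfolding qtp_snoc_def qtp_eq_iff by (simp del: sat_literal.simps)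
  with j assms(2) show False by auto
qed

text \<open>With the elements of \<open>M\<close> as their own variables, the type of the identity
  is the quantifier-free diagram of \<open>M\<close>. A map whose values satisfy the diagram is an
  embedding: equations between variables give injectivity, and the other atoms give functions and
  relations.\<close>

lemma embedding_if_qtp_eq:
  assumes M: "is_structure L M" and h: "h ` universe M \<subseteq> universe M"
    and eq: "qtp L M (universe M) (\<lambda>x. x) = qtp L M (universe M) h"
  shows "embedding L h M M"
proof -
  have sat: "sat_literal M (\<lambda>x. x) \<phi> = sat_literal M h \<phi>" if "wf_literal L (universe M) \<phi>" for \<phi>
    using eq that by (simp add: qtp_eq_iff)
  have "inj_on h (universe M)"
  proof (rule inj_onI)
    fix x y assume "x \<in> universe M" "y \<in> universe M" "h x = h y"
    with sat[of "Pos (Eq (Var x) (Var y))"] show "x = y" by auto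
  qed
  moreover have "h (fun_int M f xs) = fun_int M f (map h xs)"
    if "f \<in> fun_syms L" "xs \<in> lists (universe M)" "length xs = fun_arity L f" for f xs
  proof -
    have "fun_int M f xs \<in> universe M"
      using M that by (auto simp: is_structure_def)
    with that sat[of "Pos (Eq (Fn f (map Var xs)) (Var (fun_int M f xs)))"] show ?thesis
      by (auto simp: in_lists_conv_set comp_def)
  qed
  moreover have "rel_int M R xs = rel_int M R (map h xs)"
    if "R \<in> rel_syms L" "xs \<in> lists (universe M)" "length xs = rel_arity L R" for R xs
    using that sat[of "Pos (Rel R (map Var xs))"]
    by (auto simp: in_lists_conv_set comp_def)
  ultimately show ?thesis
    using M h by (auto simp: embedding_def)
qed

section \<open>Sunflowers\<close>

text \<open>The fibres of \<open>f\<close> partition \<open>M\<close> into fewer than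
  \<open>|M|\<close> pieces, so one of them contains a copy of \<open>M\<close>.\<close>

lemma indivisible_embedding:
  fixes M :: "('a, 'f, 'r) struct"
  assumes "indivisible L M" "is_structure L M" "|f ` universe M| <o |universe M|"
  obtains c e where "embedding L e M M" "\<And>x. x \<in> universe M \<Longrightarrow> f (e x) = c"
proof -
  \<comment> \<open>Partitions in \<open>indivisible\<close> are indexed by elements of type
    \<open>'a\<close>, so the values of \<open>f\<close> are coded by elements of
    \<open>M\<close>.\<close>
  obtain k where k: "inj_on k (f ` universe M)" "k ` f ` universe M \<subseteq> universe M"
    using ordLess_imp_ordLeq[OF assms(3)] by (auto simp flip: card_of_ordLeq)
  define P where "P i = {x \<in> universe M. k (f x) = i}" for i
  let ?I = "k ` f ` universe M"
  have "|?I| <o |universe M|"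
    using card_of_image assms(3) by (rule ordLeq_ordLess_trans)
  moreover have "disjoint_family_on P ?I" "(\<Union>i\<in>?I. P i) = universe M"
    by (auto simp: disjoint_family_on_def P_def)
  ultimately obtain i Q where i: "i \<in> ?I" and Q: "Q \<subseteq> P i" "isomorphic L (restrict_to M Q) M"
    using assms(1)[unfolded indivisible_def, rule_format, of ?I P] by auto
  obtain e where e: "embedding L e M M" "e ` universe M = Q"
    using isomorphic_restrict_imp_embedding[OF Q(2) assms(2)] Q(1) by (auto simp: P_def)
  obtain c where c: "c \<in> f ` universe M" "i = k c" using i by blast
  show thesis
  proof (rule that[OF e(1)])
    fix x assume "x \<in> universe M"
    then have "e x \<in> P i" using e(2) Q(1) by auto
    then show "f (e x) = c"
      using c k(1) by (auto simp: P_def dest: inj_onD)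
  qed
qed

text \<open>If every set in the copy met \<open>S\<close>, choosing a point of \<open>S\<close> in
  each would colour \<open>M\<close> with fewer than \<open>|M|\<close> colours. On a smaller copy
  the colour is a constant \<open>c\<close>, which then lies in every set there, contrary to
  \<open>no\<close>.\<close>

lemma embedding_avoiding:
  assumes M: "is_structure L M" "indivisible L M"
    and no: "\<And>c e. embedding L e M M \<Longrightarrow> \<exists>x\<in>universe M. c \<notin> g (e x)"
    and S: "|S| <o |universe M|" and e: "embedding L e M M"
  shows "\<exists>x\<in>universe M. g (e x) \<inter> S = {}"
proof (rule ccontr)
  assume "\<not> ?thesis"
  then have "\<forall>x\<in>universe M. \<exists>c. c \<in> g (e x) \<inter> S"
    by blast
  then obtain f where f: "f x \<in> g (e x) \<inter> S" if "x \<in> universe M" for x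
    unfolding bchoice_iff by blast
  then have "f ` universe M \<subseteq> S" by auto
  then have "|f ` universe M| <o |universe M|"
    using S card_of_mono1 ordLeq_ordLess_trans by blast
  then obtain c e' where e': "embedding L e' M M" "\<And>x. x \<in> universe M \<Longrightarrow> f (e' x) = c"
    using indivisible_embedding M by metis
  then obtain x where "x \<in> universe M" "c \<notin> g (e (e' x))"
    using no[OF embedding_comp[OF e'(1) e]] by auto
  moreover from this e' have "e' x \<in> universe M"
    by (auto simp: embedding_def)
  ultimately show False using f[of "e' x"] e'(2)[of x] by simp
qed

section \<open>A copy with pairwise disjoint sets, by transfinite recursion\<close>

lemma disjoint_embedding:
  fixes M :: "('a, 'f, 'r) struct" and g :: "'a \<Rightarrow> 'b set"
  assumes M: "is_structure L M" "infinite (universe M)" "regularCard |universe M|"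
      "indivisible L M" "ultrahomogeneous L M" "universal_duplication_qtp L M"
    and no: "\<And>c e. embedding L e M M \<Longrightarrow> \<exists>x\<in>universe M. c \<notin> g (e x)"
    and fin: "\<And>x. x \<in> universe M \<Longrightarrow> finite (g x)"
  obtains h where "embedding L h M M"
    "\<And>x y. x \<in> universe M \<Longrightarrow> y \<in> universe M \<Longrightarrow> x \<noteq> y \<Longrightarrow> g (h x) \<inter> g (h y) = {}"
proof -
  let ?U = "universe M" and ?r = "|universe M|"
  have r: "Well_order ?r" "Field ?r = ?U"
    by (rule card_of_Well_order) (rule Field_card_of)
  have below: "(y, x) \<in> ?r - Id \<longleftrightarrow> y \<in> underS ?r x" for x y
    by (auto simp: underS_def)
  \<comment> \<open>\<open>P h x z\<close> says that \<open>z\<close> is an admissible value at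
    \<open>x\<close> after the choices of \<open>h\<close> below \<open>x\<close>: it has the right
    type over them and its set is disjoint from theirs. The guard makes the condition vacuous
    outside \<open>M\<close>, since the recursion runs over the whole type.\<close>
  define P where "P h x z \<longleftrightarrow> (x \<in> ?U \<longrightarrow> z \<in> ?U \<and>
      qtp_snoc L M (underS ?r x) (\<lambda>x. x) x = qtp_snoc L M (underS ?r x) h z \<and>
      g z \<inter> (\<Union>y\<in>underS ?r x. g (h y)) = {})" for h x z
  have "\<exists>h. \<forall>x. P h x (h x)"
  proof (rule dependent_wf_choice)
    show "wf (?r - Id)"
      using r(1) by (simp add: well_order_on_def)
  next
    fix h h' :: "'a \<Rightarrow> 'a" and x z
    assume eq: "\<And>y. (y, x) \<in> ?r - Id \<Longrightarrow> h y = h' y"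
    have "qtp_snoc L M (underS ?r x) h z = qtp_snoc L M (underS ?r x) h' z"
      unfolding qtp_snoc_def qtp_eq_iff
    proof (intro allI impI sat_literal_cong)
      fix \<phi> v
      assume "wf_literal L (insert None (Some ` underS ?r x)) \<phi>" "v \<in> set3_literal \<phi>"
      with wf_literal_vars have "v \<in> insert None (Some ` underS ?r x)" by blast
      then show "case_option z h v = case_option z h' v" using eq below by auto
    qed
    moreover have "(\<Union>y\<in>underS ?r x. g (h y)) = (\<Union>y\<in>underS ?r x. g (h' y))"
      using eq below by auto
    ultimately show "P h x z = P h' x z" by (simp only: P_def)
  next
    fix x and h :: "'a \<Rightarrow> 'a"
    assume "\<And>y. (y, x) \<in> ?r - Id \<Longrightarrow> P h y (h y)"
    then have IH: "P h y (h y)" if "y \<in> underS ?r x" for y using that below by blast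
    show "\<exists>z. P h x z"
    proof (cases "x \<in> ?U")
      case True
      let ?J = "underS ?r x"
      have J: "?J \<subseteq> ?U" using r(2) by (auto simp: underS_def Field_def)
      \<comment> \<open>Proper initial segments of a cardinal are smaller than it, as both
        ultrahomogeneity and duplication demand of the length of a tuple.\<close>
      have Jless: "|?J| <o ?r"
        using True r(2) by (intro card_of_underS card_of_Card_order) simp
      have hJ: "h \<in> ?J \<rightarrow> ?U" using IH J by (auto simp: P_def)
      have "qtp L M ?J (\<lambda>x. x) = qtp L M ?J h"
        using IH J r by (intro qtp_eqI_Well_order[OF r(1)]) (auto simp: P_def)
      moreover have "(\<lambda>x. x) \<in> ?J \<rightarrow> ?U" using J by auto
      ultimately have "\<exists>b\<in>?U. qtp_snoc L M ?J (\<lambda>x. x) x = qtp_snoc L M ?J h b"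
        using M(5)[unfolded ultrahomogeneous_def, rule_format, of ?J "\<lambda>x. x" h x] Jless hJ True
        by simp
      then obtain b
        where b: "b \<in> ?U" "qtp_snoc L M ?J (\<lambda>x. x) x = qtp_snoc L M ?J h b" ..
      \<comment> \<open>\<open>x\<close> is not in its own strict segment, so it is not an entry of
        the identity tuple on \<open>?J\<close>; equality of types carries this over to
        \<open>b\<close>.\<close>
      have "b \<notin> h ` ?J"
        using qtp_snoc_eq_notin[OF b(2)] by (auto simp: underS_def)
      then obtain C where C: "C \<subseteq> same_type_set L M ?J h b"
          "isomorphic L (restrict_to M C) M"
        using M(6)[unfolded universal_duplication_qtp_def, rule_format, of ?J h b] Jless hJ b(1)
        by auto
      then have "C \<subseteq> ?U" by (auto simp: same_type_set_def)
      with C M(1) obtain e where e: "embedding L e M M" "e ` ?U = C"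
        using isomorphic_restrict_imp_embedding by blast
      let ?S = "\<Union>y\<in>?J. g (h y)"
      \<comment> \<open>This is where regularity enters: \<open>?S\<close> is a union of fewer than
        \<open>|M|\<close> finite sets.\<close>
      have "|?S| <o ?r"
      proof (rule regularCard_UNION_bound[OF _ M(3) Jless])
        show "Cinfinite ?r"
          using M(2) by (simp add: cinfinite_def Field_card_of card_of_card_order_on)
        show "|g (h y)| <o ?r" if "y \<in> ?J" for y
          using that hJ fin M(2) by (intro finite_ordLess_infinite card_of_Well_order) (auto simp: Field_card_of)
      qed
      \<comment> \<open>The value at \<open>x\<close> is not \<open>b\<close> but some
        \<open>e y\<close> in the copy \<open>C\<close>: it realizes the same type as
        \<open>b\<close>, and its set avoids \<open>?S\<close>.\<close>
      with embedding_avoiding[OF M(1,4), of g ?S e] no e(1) obtain y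
        where y: "y \<in> ?U" "g (e y) \<inter> ?S = {}" by auto
      then have "e y \<in> same_type_set L M ?J h b" using e C by auto
      then have "P h x (e y)"
        using y b(2) unfolding P_def same_type_set_def by auto
      then show ?thesis ..
    qed (auto simp: P_def)
  qed
  then obtain h where h: "\<And>x. P h x (h x)" by auto
  have hU: "h ` ?U \<subseteq> ?U" using h by (auto simp: P_def)
  have "qtp L M ?U (\<lambda>x. x) = qtp L M ?U h"
    using h r by (intro qtp_eqI_Well_order[OF r(1)]) (auto simp: P_def)
  with M(1) hU have "embedding L h M M" by (rule embedding_if_qtp_eq)
  moreover have "g (h x) \<inter> g (h y) = {}" if xy: "x \<in> ?U" "y \<in> ?U" "x \<noteq> y" for x y
  proof -
    \<comment> \<open>Whichever of the two comes later was chosen with its set disjoint from that of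
      the earlier one.\<close>
    have "x \<in> underS ?r y \<or> y \<in> underS ?r x"
      using xy r unfolding order_on_defs total_on_def underS_def by auto
    moreover have "g (h v) \<inter> g (h u) = {}" if "u \<in> underS ?r v" "v \<in> ?U" for u v
      using h[of v] that by (auto simp: P_def)
    ultimately show ?thesis using xy by blast
  qed
  ultimately show thesis by (rule that)
qed

section \<open>Induction on the size of the sets\<close>

lemma sunflowerI:
  assumes "\<And>x. x \<in> A \<Longrightarrow> finite (f x)"
    and "\<And>x y. x \<in> A \<Longrightarrow> y \<in> A \<Longrightarrow> f x \<noteq> f y \<Longrightarrow> f x \<inter> f y = r"
  shows "sunflower (f ` A)"
  unfolding sunflower_def
proof (intro conjI exI ballI impI)
  show "finite p" if "p \<in> f ` A" for p
    using that assms(1) by auto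
  show "p \<inter> q = r" if pq: "p \<in> f ` A" "q \<in> f ` A" "p \<noteq> q" for p q
  proof -
    obtain x y where "p = f x" "x \<in> A" "q = f y" "y \<in> A"
      using pq(1,2) by (elim imageE)
    with pq(3) show ?thesis
      using assms(2)[of x y] by simp
  qed
qed

text \<open>The structure on sets is replaced by a labelling \<open>g\<close> of \<open>M\<close> by
  sets, so the induction can change the labels while \<open>M\<close> stays fixed.\<close>

lemma sunflower_embedding:
  fixes M :: "('a, 'f, 'r) struct" and g :: "'a \<Rightarrow> 'b set"
  assumes M: "is_structure L M" "infinite (universe M)" "regularCard |universe M|"
      "indivisible L M" "ultrahomogeneous L M" "universal_duplication_qtp L M"
    and "inj_on g (universe M)" "\<And>x. x \<in> universe M \<Longrightarrow> finite (g x) \<and> card (g x) = n"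
  shows "\<exists>e. embedding L e M M \<and> sunflower (g ` e ` universe M)"
  using assms(7,8)
proof (induction n arbitrary: g)
  case 0
  then have "g x = {}" if "x \<in> universe M" for x
    using that by fastforce
  then have "g ` universe M \<subseteq> {{}}" by blast
  then have "finite (universe M)"
    using 0(1) by (meson finite.emptyI finite.insertI inj_on_finite)
  with M(2) show ?case by simp
next
  case (Suc n)
  show ?case
  proof (cases "\<exists>c e. embedding L e M M \<and> (\<forall>x\<in>universe M. c \<in> g (e x))")
    case True
    then obtain c e where e: "embedding L e M M" and c: "\<And>x. x \<in> universe M \<Longrightarrow> c \<in> g (e x)"
      by auto
    have eU: "e x \<in> universe M" if "x \<in> universe M" for x
      using e that by (auto simp: embedding_def)
    \<comment> \<open>Removing the common point \<open>c\<close> on the copy given by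
      \<open>e\<close> lowers the size by one and keeps the labels distinct, because
      \<open>c\<close> lies in all of them.\<close>
    let ?g = "\<lambda>x. g (e x) - {c}"
    have "\<exists>e'. embedding L e' M M \<and> sunflower (?g ` e' ` universe M)"
    proof (rule Suc.IH)
      show "inj_on ?g (universe M)"
      proof (rule inj_onI)
        fix x y assume xy: "x \<in> universe M" "y \<in> universe M" "?g x = ?g y"
        then have "g (e x) = g (e y)" using c by blast
        then have "e x = e y" using xy eU Suc.prems(1) by (meson inj_onD)
        then show "x = y" using xy e by (auto simp: embedding_def dest: inj_onD)
      qed
      show "finite (?g x) \<and> card (?g x) = n" if "x \<in> universe M" for x
        using Suc.prems(2)[OF eU[OF that]] c[OF that] by simp
    qed
    then obtain e' where e': "embedding L e' M M" "sunflower (?g ` e' ` universe M)" by blast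
    then have e'U: "e' x \<in> universe M" if "x \<in> universe M" for x
      using that by (auto simp: embedding_def)
    from e'(2) obtain r where r: "\<forall>p \<in> ?g ` e' ` universe M. \<forall>q \<in> ?g ` e' ` universe M.
        p \<noteq> q \<longrightarrow> p \<inter> q = r"
      unfolding sunflower_def by (elim conjE exE)
    \<comment> \<open>Putting \<open>c\<close> back adds it to the kernel \<open>r\<close> found for
      the shortened sets.\<close>
    have "g (e (e' x)) \<inter> g (e (e' y)) = insert c r"
      if "x \<in> universe M" "y \<in> universe M" "g (e (e' x)) \<noteq> g (e (e' y))" for x y
    proof -
      have "c \<in> g (e (e' x))" "c \<in> g (e (e' y))" using c e'U that by auto
      moreover from this that(3) have "?g (e' x) \<noteq> ?g (e' y)" by blast
      then have "?g (e' x) \<inter> ?g (e' y) = r"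
        using r[rule_format, OF imageI[OF imageI[OF that(1)]] imageI[OF imageI[OF that(2)]]] by simp
      ultimately show ?thesis by blast
    qed
    moreover have "finite (g (e (e' x)))" if "x \<in> universe M" for x
      using Suc.prems(2)[OF eU[OF e'U[OF that]]] by simp
    ultimately have "sunflower (g ` (e \<circ> e') ` universe M)"
      unfolding image_image by (intro sunflowerI) simp_all
    then show ?thesis using embedding_comp[OF e'(1) e] by blast
  next
    case False
    then obtain h where h: "embedding L h M M"
      "\<And>x y. x \<in> universe M \<Longrightarrow> y \<in> universe M \<Longrightarrow> x \<noteq> y \<Longrightarrow> g (h x) \<inter> g (h y) = {}"
      using disjoint_embedding[OF M, of g] Suc.prems(2) by blast
    have "finite (g (h x))" if "x \<in> universe M" for x
      using that h(1) Suc.prems(2)[of "h x"] by (auto simp: embedding_def)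
    \<comment> \<open>Pairwise disjoint sets form a sunflower with empty kernel.\<close>
    then have "sunflower (g ` h ` universe M)"
      unfolding image_image by (intro sunflowerI[where r = "{}"]) (metis h(2))+
    with h(1) show ?thesis by blast
  qed
qed

theorem theorem2p15:
  fixes L :: "('f, 'r) language" and M :: "('a, 'f, 'r) struct"
  assumes "is_structure L M"
    and "infinite (universe M)"
    and "regularCard |universe M|"
    and "indivisible L M"
    and "ultrahomogeneous L M"
    and "universal_duplication_qtp L M"
  shows "sunflowerable TYPE('b) L M"
  unfolding sunflowerable_def n_sunflowerable_def
proof (intro allI conjI impI)
  fix n and Y :: "('b set, 'f, 'r) struct"
  assume Y: "isomorphic L Y M \<and> (\<forall>p \<in> universe Y. finite p \<and> card p = n)"
  then obtain k where k: "is_isomorphism L k Y M" by (auto simp: isomorphic_def)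
  define g where "g = inv_into (universe Y) k"
  have g: "is_isomorphism L g M Y"
    unfolding g_def using k by (rule is_isomorphism_inv_into)
  then have bij: "bij_betw g (universe M) (universe Y)"
    by (simp add: is_isomorphism_def)
  have "finite (g x) \<and> card (g x) = n" if "x \<in> universe M" for x
    using that Y bij_betwE[OF bij] by auto
  then obtain e where e: "embedding L e M M" "sunflower (g ` e ` universe M)"
    using sunflower_embedding[OF assms bij_betw_imp_inj_on[OF bij]] by blast
  \<comment> \<open>The self-embedding \<open>e\<close> of \<open>M\<close> is conjugated by the
    isomorphism \<open>k\<close> into one of \<open>Y\<close>; its range is the required
    sunflower.\<close>
  have emb: "embedding L (g \<circ> (e \<circ> k)) Y Y"
    by (rule embedding_comp[OF embedding_comp[OF is_isomorphism_imp_embedding[OF k] e(1)]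
        is_isomorphism_imp_embedding[OF g]])
  have "k ` universe Y = universe M"
    using k by (auto simp: is_isomorphism_def bij_betw_def)
  then have "(g \<circ> (e \<circ> k)) ` universe Y = g ` e ` universe M"
    by (simp only: image_comp[symmetric])
  with embedding_image[OF emb] e(2)
  show "\<exists>Z. is_substructure L Z Y \<and> isomorphic L Z Y \<and> sunflower (universe Z)"
    by (intro exI[of _ "restrict_to Y (g ` e ` universe M)"])
      (simp only: restrict_to_simps simp_thms)
qed (rule assms(2))

end
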